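(* Let $1\le j\le n$ and let $I_{n,j}$ be the number of ancestors $i$ of the node $j$ with $i>j$ in a labelled unordered rooted tree of size $n$ chosen uniformly at random. Then for $0\le k\le n-j$, $$\mathbb{P}\{I_{n,j}=k\}=\frac{(j-1)!\,(n-j)!}{n^{n-1}}\sum_{\ell=n-j-k}^{n-k-1}\binom{\ell}{n-j-k}\binom{n-\ell-1}{k}\frac{(n-\ell)\,n^{\ell-1}}{\ell!}.$$
   Context: A labelled unordered rooted tree (Cayley tree) of size $n$ is a rooted tree with vertex set $\{1,\dots,n\}$, with no order on the children of any node and with arbitrary root. Vertices are identified with their labels; $i$ is an ancestor of $j$ if $i\ne j$ lies on the path from the root to $j$. *)

theory Defs
  imports "HOL-Probability.Probability_Mass_Function"
begin

text \<open>
  An undirected simple graph on a vertex set \<open>V\<close> is given by its set \<open>E\<close> of edges, each a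
  two-element subset of \<open>V\<close>. Paths are lists of pairwise distinct vertices; \<open>[v]\<close> is the
  path of length 0 from \<open>v\<close> to itself.
\<close>

definition simple_graph :: "'a set \<Rightarrow> 'a set set \<Rightarrow> bool" where
  "simple_graph V E \<longleftrightarrow> (\<forall>e\<in>E. e \<subseteq> V \<and> card e = 2)"

definition path_between :: "'a set set \<Rightarrow> 'a \<Rightarrow> 'a list \<Rightarrow> 'a \<Rightarrow> bool" where
  "path_between E u p v \<longleftrightarrow>
     p \<noteq> [] \<and> hd p = u \<and> last p = v \<and> distinct p \<and> successively (\<lambda>x y. {x, y} \<in> E) p"

definition graph_connected :: "'a set \<Rightarrow> 'a set set \<Rightarrow> bool" where
  "graph_connected V E \<longleftrightarrow> V \<noteq> {} \<and> (\<forall>u\<in>V. \<forall>v\<in>V. \<exists>p. path_between E u p v)"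

text \<open>A cycle is listed without repeating its starting vertex at the end.\<close>

definition graph_cycle :: "'a set set \<Rightarrow> 'a list \<Rightarrow> bool" where
  "graph_cycle E c \<longleftrightarrow>
     length c \<ge> 3 \<and> distinct c \<and> successively (\<lambda>x y. {x, y} \<in> E) c \<and> {last c, hd c} \<in> E"

definition is_tree :: "'a set \<Rightarrow> 'a set set \<Rightarrow> bool" where
  "is_tree V E \<longleftrightarrow> simple_graph V E \<and> graph_connected V E \<and> (\<nexists>c. graph_cycle E c)"

definition rooted_labelled_trees :: "nat \<Rightarrow> (nat \<times> nat set set) set" where
  "rooted_labelled_trees n = {(r, E). r \<in> {1..n} \<and> is_tree {1..n} E}"

fun is_ancestor :: "'a \<times> 'a set set \<Rightarrow> 'a \<Rightarrow> 'a \<Rightarrow> bool" where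
  "is_ancestor (r, E) i j \<longleftrightarrow> i \<noteq> j \<and> (\<exists>p. path_between E r p j \<and> i \<in> set p)"

definition num_larger_ancestors :: "nat \<Rightarrow> nat \<times> nat set set \<Rightarrow> nat" where
  "num_larger_ancestors j T = card {i. is_ancestor T i j \<and> i > j}"

text \<open>
  The next two facts ensure that the uniform distribution \<^const>\<open>pmf_of_set\<close> on
  \<^const>\<open>rooted_labelled_trees\<close> is meaningful.
\<close>

lemma finite_rooted_labelled_trees: "finite (rooted_labelled_trees n)"
proof (rule finite_subset)
  show "rooted_labelled_trees n \<subseteq> {1..n} \<times> Pow (Pow {1..n})"
    by (auto simp: rooted_labelled_trees_def is_tree_def simple_graph_def)
qed simp

lemma rooted_labelled_trees_nonempty:
  assumes "n \<ge> 1"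
  shows "rooted_labelled_trees n \<noteq> {}"
proof -
  define E where "E = (\<lambda>v. {1, v}) ` {2..n}"
  have edge: "{x, y} \<in> E \<longleftrightarrow> (x = 1 \<and> y \<in> {2..n}) \<or> (y = 1 \<and> x \<in> {2..n})" for x y
    unfolding E_def image_iff doubleton_eq_iff by blast
  have "simple_graph {1..n} E"
    using assms by (auto simp: simple_graph_def E_def)
  moreover have "graph_connected {1..n} E"
    unfolding graph_connected_def
  proof (intro conjI ballI)
    fix u v assume uv: "u \<in> {1..n}" "v \<in> {1..n}"
    consider "u = v" | "u \<noteq> v" "u = 1 \<or> v = 1" | "u \<noteq> v" "u \<noteq> 1" "v \<noteq> 1" by blast
    then show "\<exists>p. path_between E u p v"
    proof cases
      case 1
      then have "path_between E u [u] v" by (simp add: path_between_def)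
      then show ?thesis ..
    next
      case 2
      then have "{u, v} \<in> E" using uv unfolding edge by force
      then have "path_between E u [u, v] v" using 2 by (simp add: path_between_def)
      then show ?thesis ..
    next
      case 3
      then have "{u, 1} \<in> E" "{1, v} \<in> E" using uv unfolding edge by force+
      then have "path_between E u [u, 1, v] v" using 3 by (simp add: path_between_def)
      then show ?thesis ..
    qed
  qed (use assms in auto)
  moreover have "\<not> graph_cycle E c" for c
  proof
    assume c: "graph_cycle E c"
    then obtain x y z zs where c_eq: "c = x # y # z # zs"
      unfolding graph_cycle_def numeral_3_eq_3 Suc_le_length_iff by blast
    define w where "w = last (z # zs)"
    have w: "w \<in> set (z # zs)"
      unfolding w_def by (rule last_in_set) simp
    have edges: "{x, y} \<in> E" "{y, z} \<in> E" "{w, x} \<in> E" and "distinct c"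
      using c by (simp_all add: graph_cycle_def c_eq w_def)
    then have "x \<noteq> y" "x \<noteq> z" "w \<noteq> y"
      using w by (auto simp: c_eq)
    with edges show False
      unfolding edge by auto
  qed
  ultimately have "(1, E) \<in> rooted_labelled_trees n"
    using assms by (auto simp: rooted_labelled_trees_def is_tree_def)
  then show ?thesis by blast
qed

end

theory Submission
  imports Defs "HOL-Combinatorics.Multiset_Permutations"
begin

text \<open>
  A tree with root \<open>r\<close> is the same thing as an acyclic parent function on the remaining vertices,
  and the ancestors of \<open>j\<close> are the vertices on the unique path from \<open>r\<close> to \<open>j\<close>. The proof
  classifies rooted trees by this path. Cutting the edges of a root path \<open>p\<close> leaves an arbitrary
  forest on the \<open>n\<close> vertices whose roots are exactly the vertices of \<open>p\<close>
  (\<open>card_forests_containing_path\<close>), and by Cayley's formula for forests with prescribed roots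
  (\<open>card_forests\<close>) there are \<open>m * n ^ (n - m - 1)\<close> of these when \<open>p\<close> has \<open>m\<close> vertices
  (for \<open>m = n\<close> the exponent is \<open>-1\<close> and the number is 1). In particular the number of trees depends on the length of the path alone.

  A root path to \<open>j\<close> with \<open>k\<close> larger and \<open>c\<close> smaller ancestors is a choice of \<open>k\<close> of the \<open>n - j\<close>
  larger labels, of \<open>c\<close> of the \<open>j - 1\<close> smaller labels, and of an order on these \<open>k + c\<close> labels. So the
  number of favourable trees is the sum over \<open>c\<close> of
  \<open>((n - j) choose k) * ((j - 1) choose c) * fact (k + c) * (k + c + 1) * n ^ (n - k - c - 2)\<close>.
  The total is \<open>n ^ (n - 1)\<close>, because trees with root \<open>r\<close> are those containing the path \<open>[r]\<close>. The
  substitution \<open>l = n - 1 - k - c\<close> and a rearrangement of factorials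
  (\<open>path_weight_binomials\<close>) give the stated form.
\<close>

section \<open>Forests with prescribed roots\<close>

text \<open>
  A forest on \<open>V\<close> with root set \<open>R\<close>, given by its parent function. Acyclicity is expressed by a rank
  \<open>d\<close> that decreases towards the roots: transferring a forest to other roots then only
  requires writing down a new rank.
\<close>
definition forests :: "'a set \<Rightarrow> 'a set \<Rightarrow> ('a \<Rightarrow> 'a) set" where
  "forests V R = {f \<in> (V - R) \<rightarrow>\<^sub>E V. \<exists>d :: 'a \<Rightarrow> nat. \<forall>v\<in>V - R. d (f v) < d v}"

lemma finite_forests: "finite V \<Longrightarrow> finite (forests V R)"
  unfolding forests_def by (rule finite_subset[of _ "(V - R) \<rightarrow>\<^sub>E V"]) (auto intro: finite_PiE)

lemma forests_no_roots:
  assumes "finite V" "V \<noteq> {}"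
  shows "forests V {} = {}"
proof (rule ccontr)
  assume "forests V {} \<noteq> {}"
  then obtain f and d :: "'a \<Rightarrow> nat"
    where f: "f \<in> V \<rightarrow>\<^sub>E V" "\<forall>v\<in>V. d (f v) < d v"
    unfolding forests_def by auto
  have "arg_min_on d V \<in> V" by (rule arg_min_if_finite) (use assms in auto)
  moreover have "f (arg_min_on d V) \<in> V" using f(1) calculation by auto
  ultimately show False
    using arg_min_least[OF assms, of "f (arg_min_on d V)" d] f(2) by fastforce
qed

lemma sum_Pow_card:
  fixes g :: "nat \<Rightarrow> 'b::comm_semiring_1"
  assumes "finite A"
  shows "(\<Sum>S\<in>Pow A. g (card S)) = (\<Sum>s\<le>card A. of_nat (card A choose s) * g s)"
proof -
  have "(\<Sum>S\<in>Pow A. g (card S)) = (\<Sum>s\<le>card A. \<Sum>S\<in>{S \<in> Pow A. card S = s}. g (card S))"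
    by (rule sum.group[symmetric]) (use assms in \<open>auto intro: card_mono\<close>)
  also have "\<dots> = (\<Sum>s\<le>card A. of_nat (card A choose s) * g s)"
    using n_subsets[OF assms] by (intro sum.cong) (simp_all)
  finally show ?thesis .
qed

text \<open>
  Let \<open>S\<close> be the set of children of roots. A forest amounts to \<open>S\<close>, an arbitrary function from \<open>S\<close> to
  the roots, and a forest with root set \<open>S\<close> on the non-roots.
\<close>
lemma card_forests_first_level:
  assumes "finite V" "R \<subseteq> V"
  shows "card (forests V R) = (\<Sum>S\<in>Pow (V - R). card R ^ card S * card (forests (V - R) S))"
proof -
  let ?W = "V - R"
  let ?X = "SIGMA S:Pow ?W. (S \<rightarrow>\<^sub>E R) \<times> forests ?W S"
  let ?to = "\<lambda>f. ({v \<in> ?W. f v \<in> R}, restrict f {v \<in> ?W. f v \<in> R}, restrict f {v \<in> ?W. f v \<notin> R})"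
  let ?from = "\<lambda>(S, h, g) v. if v \<in> S then h v else g v"
  have "bij_betw ?to (forests V R) ?X"
  proof (rule bij_betw_byWitness[where f' = ?from])
    show "\<forall>f\<in>forests V R. ?from (?to f) = f"
      by (auto simp: forests_def fun_eq_iff PiE_def extensional_def)
    show "\<forall>t\<in>?X. ?to (?from t) = t"
    proof
      fix t assume "t \<in> ?X"
      then obtain S h g where t: "t = (S, h, g)" "S \<subseteq> ?W" "h \<in> S \<rightarrow>\<^sub>E R" "g \<in> (?W - S) \<rightarrow>\<^sub>E ?W"
        by (auto simp: forests_def)
      have S: "{v \<in> ?W. ?from t v \<in> R} = S" "{v \<in> ?W. ?from t v \<notin> R} = ?W - S"
        using t by (auto split: if_splits)
      have "restrict (?from t) S = h" "restrict (?from t) (?W - S) = g"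
        using t by (auto simp: fun_eq_iff PiE_def extensional_def)
      then show "?to (?from t) = t" unfolding S by (simp add: t)
    qed
    show "?to ` forests V R \<subseteq> ?X"
    proof
      fix t assume "t \<in> ?to ` forests V R"
      then obtain f and d :: "'a \<Rightarrow> nat" where f: "t = ?to f" "f \<in> ?W \<rightarrow>\<^sub>E V" "\<forall>v\<in>?W. d (f v) < d v"
        by (auto simp: forests_def)
      have "restrict f {v \<in> ?W. f v \<notin> R} \<in> forests ?W {v \<in> ?W. f v \<in> R}"
        unfolding forests_def
      proof (intro CollectI conjI exI[of _ d])
        have "?W - {v \<in> ?W. f v \<in> R} = {v \<in> ?W. f v \<notin> R}" by blast
        then show "restrict f {v \<in> ?W. f v \<notin> R} \<in> (?W - {v \<in> ?W. f v \<in> R}) \<rightarrow>\<^sub>E ?W"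
          using f(2) by auto
      qed (use f in auto)
      with f show "t \<in> ?X" by auto
    qed
    show "?from ` ?X \<subseteq> forests V R"
    proof
      fix f assume "f \<in> ?from ` ?X"
      then obtain S h g and d :: "'a \<Rightarrow> nat"
        where t: "f = ?from (S, h, g)" "S \<subseteq> ?W" "h \<in> S \<rightarrow>\<^sub>E R" "g \<in> (?W - S) \<rightarrow>\<^sub>E ?W"
          "\<forall>v\<in>?W - S. d (g v) < d v"
        by (auto simp: forests_def)
      have "f \<in> ?W \<rightarrow>\<^sub>E V" 
      proof (rule PiE_I)
        show "f v \<in> V" if "v \<in> ?W" for v
          using t(3,4) assms(2) that unfolding t(1) by (auto dest: PiE_mem)
        show "f v = undefined" if "v \<notin> ?W" for v
          using t(2,4) that unfolding t(1) by (auto simp: PiE_def extensional_def)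
      qed
      moreover have "\<forall>v\<in>?W. (if f v \<in> R then 0 else Suc (d (f v))) < (if v \<in> R then 0 else Suc (d v))"
        using t by auto
      ultimately show "f \<in> forests V R" unfolding forests_def
        by (intro CollectI conjI exI[of _ "\<lambda>v. if v \<in> R then 0 else Suc (d v)"])
    qed
  qed
  then have "card (forests V R) = card ?X" by (rule bij_betw_same_card)
  also have "\<dots> = (\<Sum>S\<in>Pow ?W. card ((S \<rightarrow>\<^sub>E R) \<times> forests ?W S))"
    by (rule card_SigmaI)
      (use assms in \<open>auto intro!: finite_cartesian_product finite_PiE finite_forests
        intro: finite_subset\<close>)
  also have "\<dots> = (\<Sum>S\<in>Pow ?W. card R ^ card S * card (forests ?W S))"
  proof (rule sum.cong[OF refl])
    fix S assume "S \<in> Pow ?W"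
    then have "finite S" using assms(1) by (auto intro: finite_subset)
    then show "card ((S \<rightarrow>\<^sub>E R) \<times> forests ?W S) = card R ^ card S * card (forests ?W S)"
      by (simp add: card_cartesian_product card_PiE)
  qed
  finally show ?thesis .
qed

text \<open>
  This is \<open>r\<close> times the derivative of \<open>(r + N) ^ N\<close> with respect to \<open>r\<close>, expanded by the
  binomial theorem.
\<close>
lemma binomial_sum_weighted:
  fixes r :: nat
  shows "(\<Sum>s\<le>N. (N choose s) * (r ^ s * (s * N ^ (N - s)))) = N * (r * (r + N) ^ (N - 1))"
proof (cases N)
  case (Suc M)
  have "(\<Sum>s\<le>N. (N choose s) * (r ^ s * (s * N ^ (N - s))))
      = (\<Sum>s\<le>M. (N choose Suc s) * (r ^ Suc s * (Suc s * N ^ (M - s))))"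
    unfolding Suc by (subst sum.atMost_Suc_shift) simp
  also have "\<dots> = (\<Sum>s\<le>M. N * r * ((M choose s) * r ^ s * N ^ (M - s)))"
  proof (rule sum.cong[OF refl])
    fix s
    have "Suc s * (N choose Suc s) = N * (M choose s)"
      unfolding Suc by (rule Suc_times_binomial)
    then have "(Suc s * (N choose Suc s)) * (r ^ Suc s * N ^ (M - s))
        = (N * (M choose s)) * (r ^ Suc s * N ^ (M - s))" by simp
    then show "(N choose Suc s) * (r ^ Suc s * (Suc s * N ^ (M - s)))
        = N * r * ((M choose s) * r ^ s * N ^ (M - s))"
      by (simp add: algebra_simps)
  qed
  also have "\<dots> = N * r * (r + N) ^ M"
    unfolding binomial[of r N M] by (simp add: sum_distrib_left)
  finally show ?thesis by (simp only: Suc diff_Suc_1 mult.assoc)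
qed simp

text \<open>
  Cayley's formula for forests. The factor \<open>card V\<close> on the left makes the formula valid also for
  \<open>R = V\<close> and for \<open>R = {}\<close>, so that the induction along the first level needs no exceptions.
\<close>
lemma card_forests:
  assumes "finite V" "R \<subseteq> V"
  shows "card V * card (forests V R) = card R * card V ^ card (V - R)"
  using assms
proof (induction "card (V - R)" arbitrary: V R rule: less_induct)
  case less
  let ?W = "V - R" and ?N = "card (V - R)"
  have [simp]: "finite ?W" using less.prems by simp
  have cV: "card V = card R + ?N"
    using less.prems by (metis card_Diff_subset card_mono finite_subset le_add_diff_inverse)
  show ?case
  proof (cases "?W = {}")
    case True
    then have "V = R" using less.prems by auto
    moreover have "forests V V = {\<lambda>_. undefined}" by (auto simp: forests_def)
    ultimately show ?thesis by simp
  next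
    case False
    then have N: "?N > 0" by (simp add: card_gt_0_iff)
    \<comment> \<open>The induction hypothesis needs a smaller set of non-roots, hence some child of a root;
      without one there are no forests at all.\<close>
    have level: "?N * card (forests ?W S) = card S * ?N ^ (?N - card S)" if S: "S \<subseteq> ?W" for S
    proof (cases "S = {}")
      case True
      then show ?thesis using forests_no_roots[of ?W] False by simp
    next
      case ne: False
      have fS: "finite S" using S by (rule finite_subset) simp
      have c: "card (?W - S) = ?N - card S" using fS S by (rule card_Diff_subset)
      have "card S > 0" using ne fS by (simp add: card_gt_0_iff)
      then have "card (?W - S) < ?N" using N c by linarith
      from less.hyps[OF this _ S] c show ?thesis by simp
    qed
    have "?N * card (forests V R) = (\<Sum>S\<in>Pow ?W. card R ^ card S * (?N * card (forests ?W S)))"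
      unfolding card_forests_first_level[OF less.prems] sum_distrib_left
      by (simp add: mult.left_commute)
    also have "\<dots> = (\<Sum>S\<in>Pow ?W. card R ^ card S * (card S * ?N ^ (?N - card S)))"
      by (intro sum.cong refl) (simp add: level)
    also have "\<dots> = (\<Sum>s\<le>?N. (?N choose s) * (card R ^ s * (s * ?N ^ (?N - s))))"
      by (subst sum_Pow_card) simp_all
    also have "\<dots> = ?N * (card R * card V ^ (?N - 1))"
      unfolding binomial_sum_weighted cV ..
    finally have "card (forests V R) = card R * card V ^ (?N - 1)"
      using N by (simp only: nat_mult_eq_cancel1)
    then show ?thesis using N by (cases ?N) simp_all
  qed
qed

section \<open>Rooted trees as parent functions\<close>

definition parent_edges :: "'a set \<Rightarrow> 'a \<Rightarrow> ('a \<Rightarrow> 'a) \<Rightarrow> 'a set set" where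
  "parent_edges V r f = (\<lambda>v. {v, f v}) ` (V - {r})"

lemma parent_edges_iff:
  "{x, y} \<in> parent_edges V r f \<longleftrightarrow> (x \<in> V - {r} \<and> f x = y) \<or> (y \<in> V - {r} \<and> f y = x)"
  unfolding parent_edges_def image_iff doubleton_eq_iff by auto

text \<open>A walk becomes a path when it is cut back to the earlier visit at each repeated vertex.\<close>
lemma path_between_if_rtranclp:
  assumes "(\<lambda>x y. {x, y} \<in> E)\<^sup>*\<^sup>* u v"
  shows "\<exists>p. path_between E u p v"
  using assms
proof induction
  case base
  have "path_between E u [u] u" by (simp add: path_between_def)
  then show ?case ..
next
  case (step y z)
  then obtain p where p: "path_between E u p y" by blast
  show ?case
  proof (cases "z \<in> set p")
    case True
    then obtain a b where ab: "p = a @ z # b" by (meson split_list)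
    then have "path_between E u (a @ [z]) z"
      using p by (auto simp: path_between_def successively_append_iff hd_append)
    then show ?thesis ..
  next
    case False
    then have "path_between E u (p @ [z]) z"
      using p step by (auto simp: path_between_def successively_append_iff)
    then show ?thesis ..
  qed
qed

lemma rtranclp_if_path_between:
  assumes "path_between E u p v"
  shows "(\<lambda>x y. {x, y} \<in> E)\<^sup>*\<^sup>* u v"
  using assms
proof (induction p arbitrary: u)
  case (Cons a p)
  show ?case
  proof (cases p)
    case Nil
    with Cons.prems show ?thesis by (auto simp: path_between_def)
  next
    case (Cons b q)
    have "path_between E b p v" "{u, b} \<in> E"
      using Cons.prems Cons by (auto simp: path_between_def)
    with Cons.IH show ?thesis by (meson converse_rtranclp_into_rtranclp)
  qed
qed (simp add: path_between_def)

lemma rtranclp_root: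
  assumes f: "f \<in> forests V {r}" and "v \<in> V"
  shows "(\<lambda>x y. {x, y} \<in> parent_edges V r f)\<^sup>*\<^sup>* v r"
proof -
  obtain d :: "'a \<Rightarrow> nat" where d: "\<forall>v\<in>V - {r}. d (f v) < d v" and "f \<in> (V - {r}) \<rightarrow>\<^sub>E V"
    using f by (auto simp: forests_def)
  then show ?thesis using \<open>v \<in> V\<close>
  proof (induction "d v" arbitrary: v rule: less_induct)
    case less
    show ?case
    proof (cases "v = r")
      case False
      then have "{v, f v} \<in> parent_edges V r f" using less.prems by (simp add: parent_edges_iff)
      moreover have "f v \<in> V" "d (f v) < d v" using less.prems False by auto
      ultimately show ?thesis using less.hyps[of "f v"] less.prems
        by (meson converse_rtranclp_into_rtranclp)
    qed simp
  qed
qed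

lemma graph_connected_parent_edges:
  assumes f: "f \<in> forests V {r}" and "r \<in> V"
  shows "graph_connected V (parent_edges V r f)"
  unfolding graph_connected_def
proof (intro conjI ballI)
  fix u v assume "u \<in> V" "v \<in> V"
  let ?A = "\<lambda>x y. {x, y} \<in> parent_edges V r f"
  have "symp ?A" by (auto simp: symp_def insert_commute)
  from symp_rtranclp[OF this] have "?A\<^sup>*\<^sup>* r v"
    by (rule sympD) (rule rtranclp_root[OF f \<open>v \<in> V\<close>])
  with rtranclp_root[OF f \<open>u \<in> V\<close>] have "?A\<^sup>*\<^sup>* u v" by simp
  then show "\<exists>p. path_between (parent_edges V r f) u p v" by (rule path_between_if_rtranclp)
qed (use assms in auto)

text \<open>
  A vertex of maximal rank on a cycle cannot be the parent of its neighbours there. So both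
  neighbours are its parent, although they are distinct.
\<close>
lemma no_cycle_parent_edges:
  assumes f: "f \<in> forests V {r}"
  shows "\<not> graph_cycle (parent_edges V r f) c"
proof
  assume "graph_cycle (parent_edges V r f) c"
  then have c: "length c \<ge> 3" "distinct c"
      "successively (\<lambda>x y. {x, y} \<in> parent_edges V r f) c" "{last c, hd c} \<in> parent_edges V r f"
    by (auto simp: graph_cycle_def)
  define L where "L = length c"
  obtain d :: "'a \<Rightarrow> nat" where d: "\<forall>v\<in>V - {r}. d (f v) < d v"
    using f by (auto simp: forests_def)
  have edge: "{c ! i, c ! (Suc i mod L)} \<in> parent_edges V r f" if "i < L" for i
  proof (cases "Suc i = L")
    case True
    then show ?thesis using c(1,4) unfolding L_def
      by (metis Suc_length_conv Zero_not_Suc diff_Suc_1 hd_conv_nth last_conv_nth list.size(3) mod_self)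
  next
    case False
    then show ?thesis using c(3) that unfolding L_def
      by (simp add: successively_conv_nth)
  qed
  have "finite (set c)" "set c \<noteq> {}" using c(1) by auto
  then have "Max (d ` set c) \<in> d ` set c" by (intro Max_in) auto
  then obtain v where v: "v \<in> set c" "Max (d ` set c) = d v" by blast
  then have max: "d w \<le> d v" if "w \<in> set c" for w
    using that by (metis List.finite_set Max_ge finite_imageI imageI)
  from v(1) obtain i where i: "i < L" "c ! i = v" unfolding L_def by (auto simp: in_set_conv_nth)
  \<comment> \<open>the cyclic predecessor of the position \<open>i\<close>\<close>
  define i' where "i' = (if i = 0 then L - 1 else i - 1)"
  have i': "i' < L" "Suc i' mod L = i" using i c(1) by (auto simp: i'_def L_def)
  have top: "w = f v" if "{v, w} \<in> parent_edges V r f" "w \<in> set c" for w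
    using that(1) d max[OF that(2)] unfolding parent_edges_iff by (metis leD)
  have "c ! (Suc i mod L) = f v"
    using edge[OF i(1)] i c(1)
    by (intro top) (auto simp: L_def intro!: nth_mem mod_less_divisor)
  moreover have "c ! i' = f v"
    using top[of "c ! i'"] edge[OF i'(1)] i i' by (simp add: L_def insert_commute)
  ultimately have "Suc i mod L = i'"
    using c(2) i' i by (metis L_def mod_less_divisor nth_eq_iff_index_eq not_less_zero gr_zeroI)
  then show False using i c(1) by (cases "Suc i = L") (auto simp: i'_def L_def split: if_splits)
qed

lemma is_tree_parent_edges:
  assumes f: "f \<in> forests V {r}" and "r \<in> V"
  shows "is_tree V (parent_edges V r f)"
proof -
  have "simple_graph V (parent_edges V r f)"
    unfolding simple_graph_def
  proof
    fix e assume "e \<in> parent_edges V r f"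
    then obtain v where v: "v \<in> V - {r}" "e = {v, f v}" by (auto simp: parent_edges_def)
    moreover have "f v \<in> V" using f v(1) by (auto simp: forests_def)
    moreover have "f v \<noteq> v"
    proof
      assume "f v = v"
      moreover obtain d :: "'a \<Rightarrow> nat" where "\<forall>v\<in>V - {r}. d (f v) < d v"
        using f by (auto simp: forests_def)
      ultimately show False using v(1) by (metis less_irrefl)
    qed
    ultimately show "e \<subseteq> V \<and> card e = 2" by auto
  qed
  then show ?thesis
    using graph_connected_parent_edges[OF assms] no_cycle_parent_edges[OF f]
    by (simp add: is_tree_def)
qed

text \<open>
  The edges and the root determine the parents, by induction on the rank: if the edge from \<open>v\<close> to
  \<open>f v\<close> were oriented the other way by \<open>g\<close>, then \<open>f (f v) = g (f v) = v\<close>, against the rank.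
\<close>
lemma inj_on_parent_edges: "inj_on (parent_edges V r) (forests V {r})"
proof (rule inj_onI)
  fix f g assume fg: "f \<in> forests V {r}" "g \<in> forests V {r}"
    and eq: "parent_edges V r f = parent_edges V r g"
  obtain d :: "'a \<Rightarrow> nat" where d: "\<forall>v\<in>V - {r}. d (f v) < d v" and f: "f \<in> (V - {r}) \<rightarrow>\<^sub>E V"
    using fg by (auto simp: forests_def)
  have g: "g \<in> (V - {r}) \<rightarrow>\<^sub>E V" using fg by (auto simp: forests_def)
  have "f v = g v" if "v \<in> V - {r}" for v
    using that
  proof (induction "d v" arbitrary: v rule: less_induct)
    case less
    have "{v, f v} \<in> parent_edges V r g"
      using less.prems unfolding eq[symmetric] parent_edges_iff by simp
    then consider "g v = f v" | "f v \<in> V - {r}" "g (f v) = v"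
      unfolding parent_edges_iff by auto
    then show ?case
    proof cases
      case 2
      have "d (f v) < d v" using d less.prems by blast
      moreover from this have "f (f v) = v" using less.hyps[of "f v"] 2 by simp
      moreover have "d (f (f v)) < d (f v)" using d 2(1) by blast
      ultimately show ?thesis by simp
    qed simp
  qed
  then show "f = g" by (rule PiE_ext[OF f g])
qed

text \<open>
  Let the parent of a vertex be any neighbour that is closer to the root. The parent edges already
  connect all vertices, so a further edge would close a cycle.
\<close>
lemma tree_has_parent_function:
  assumes E: "is_tree V E" and "r \<in> V"
  obtains f where "f \<in> forests V {r}" "E = parent_edges V r f"
proof -
  have simple: "simple_graph V E" and con: "graph_connected V E" and acyc: "\<And>c. \<not> graph_cycle E c"
    using E by (auto simp: is_tree_def)
  define d where "d v = (LEAST k. ((\<lambda>x y. {x, y} \<in> E) ^^ k) v r)" for v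
  have closer: "\<exists>w. w \<in> V \<and> {v, w} \<in> E \<and> d w < d v" if v: "v \<in> V - {r}" for v
  proof -
    let ?A = "\<lambda>x y. {x, y} \<in> E"
    obtain p where "path_between E v p r"
      using con v \<open>r \<in> V\<close> unfolding graph_connected_def by blast
    then have "?A\<^sup>*\<^sup>* v r" by (rule rtranclp_if_path_between)
    then have "\<exists>k. (?A ^^ k) v r" by (simp add: rtranclp_power)
    then have dv: "(?A ^^ d v) v r" unfolding d_def by (rule LeastI_ex)
    have "d v \<noteq> 0" using dv v by (metis DiffD2 relpowp_0_E singletonI)
    then obtain m where m: "d v = Suc m" using not0_implies_Suc by blast
    from dv have "(?A ^^ Suc m) v r" unfolding m .
    then obtain w where w: "{v, w} \<in> E" "(?A ^^ m) w r" by (rule relpowp_Suc_E2)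
    have "d w \<le> m" unfolding d_def using w(2) by (rule Least_le)
    moreover have "w \<in> V" using simple w(1) by (auto simp: simple_graph_def)
    ultimately show ?thesis using w m by auto
  qed
  define f where "f = (\<lambda>v\<in>V - {r}. SOME w. w \<in> V \<and> {v, w} \<in> E \<and> d w < d v)"
  have f: "f v \<in> V \<and> {v, f v} \<in> E \<and> d (f v) < d v" if v: "v \<in> V - {r}" for v
    using someI_ex[OF closer[OF v]] v by (simp add: f_def)
  have "f \<in> (V - {r}) \<rightarrow>\<^sub>E V" using f by (auto simp: f_def)
  with f have forest: "f \<in> forests V {r}" unfolding forests_def by blast
  have sub: "parent_edges V r f \<subseteq> E" using f by (auto simp: parent_edges_def)
  have "E \<subseteq> parent_edges V r f"
  proof
    fix e assume e: "e \<in> E"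
    show "e \<in> parent_edges V r f"
    proof (rule ccontr)
      assume ne: "e \<notin> parent_edges V r f"
      obtain x y where xy: "e = {x, y}" "x \<noteq> y" "x \<in> V" "y \<in> V"
        using simple e unfolding simple_graph_def by (metis card_2_iff insert_subset)
      obtain p where p: "path_between (parent_edges V r f) x p y"
        using graph_connected_parent_edges[OF forest \<open>r \<in> V\<close>] xy by (auto simp: graph_connected_def)
      obtain a b q where "p = a # b # q"
        using p xy(2) unfolding path_between_def by (metis last_ConsL list.sel(1) list.exhaust)
      moreover from this have "q \<noteq> []" using p ne xy by (auto simp: path_between_def)
      ultimately have "length p \<ge> 3" by (cases q) auto
      moreover have "successively (\<lambda>x y. {x, y} \<in> E) p"
        using p sub unfolding path_between_def by (blast intro: successively_mono)
      ultimately have "graph_cycle E p"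
        using p e xy by (auto simp: graph_cycle_def path_between_def insert_commute)
      then show False using acyc by blast
    qed
  qed
  with sub forest that show thesis by blast
qed

lemma bij_betw_parent_edges:
  assumes "r \<in> V"
  shows "bij_betw (parent_edges V r) (forests V {r}) {E. is_tree V E}"
  unfolding bij_betw_def
proof (intro conjI equalityI subsetI)
  show "inj_on (parent_edges V r) (forests V {r})" by (rule inj_on_parent_edges)
  show "E \<in> {E. is_tree V E}" if "E \<in> parent_edges V r ` forests V {r}" for E
    using that is_tree_parent_edges[OF _ assms] by auto
  show "E \<in> parent_edges V r ` forests V {r}" if "E \<in> {E. is_tree V E}" for E
    using that tree_has_parent_function[OF _ assms, of E] by auto
qed

section \<open>Root paths\<close>

lemma path_between_subset:
  assumes "simple_graph V E" "path_between E u p v" "u \<in> V"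
  shows "set p \<subseteq> V"
  using assms(2,3)
proof (induction p arbitrary: u)
  case (Cons a p)
  show ?case
  proof (cases p)
    case Nil
    with Cons.prems show ?thesis by (auto simp: path_between_def)
  next
    case (Cons b q)
    then have "path_between E b p v" "{a, b} \<in> E" "u = a"
      using Cons.prems by (auto simp: path_between_def)
    moreover from this have "b \<in> V" using assms(1) by (auto simp: simple_graph_def)
    ultimately show ?thesis using Cons.IH[of b] Cons.prems by simp
  qed
qed simp

text \<open>
  A path that leaves the root never traverses an edge upwards: after a downward step to \<open>y\<close>, the
  only upward edge at \<open>y\<close> leads back to the previous vertex. The third assumption carries this
  through the induction.
\<close>
lemma successively_parent_edges_Cons:
  assumes "set ps \<subseteq> V - {r}" "distinct (x # ps)" "x = r \<or> f x \<notin> set ps"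
  shows "successively (\<lambda>x y. {x, y} \<in> parent_edges V r f) (x # ps)
    \<longleftrightarrow> successively (\<lambda>x y. f y = x) (x # ps)"
  using assms
proof (induction ps arbitrary: x)
  case (Cons y ps)
  have "{x, y} \<in> parent_edges V r f \<longleftrightarrow> f y = x"
    using Cons.prems unfolding parent_edges_iff by auto
  moreover have "successively (\<lambda>x y. {x, y} \<in> parent_edges V r f) (y # ps)
      \<longleftrightarrow> successively (\<lambda>x y. f y = x) (y # ps)" if "f y = x"
    using Cons.prems that by (intro Cons.IH) auto
  ultimately show ?case by auto
qed simp

lemma successively_parent_edges:
  assumes "set p \<subseteq> V" "distinct p" "p \<noteq> []" "hd p = r"
  shows "successively (\<lambda>x y. {x, y} \<in> parent_edges V r f) p \<longleftrightarrow> successively (\<lambda>x y. f y = x) p"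
  using assms successively_parent_edges_Cons[of "tl p" V r r f] by (cases p) auto

text \<open>Read backwards from \<open>v\<close>, a root path iterates the parent function.\<close>
lemma tree_path_unique:
  assumes E: "is_tree V E" and "r \<in> V" and p: "path_between E r p v" and q: "path_between E r q v"
  shows "p = q"
proof -
  obtain f where f: "E = parent_edges V r f"
    using tree_has_parent_function[OF E \<open>r \<in> V\<close>] by blast
  have chain: "p \<noteq> [] \<and> hd p = r \<and> last p = v \<and> distinct p \<and> successively (\<lambda>x y. f y = x) p"
    if "path_between E r p v" for p
    using that path_between_subset[OF _ that \<open>r \<in> V\<close>] E successively_parent_edges[of p V r f]
    by (auto simp: path_between_def f is_tree_def)
  show ?thesis using chain[OF p] chain[OF q]
  proof (induction p arbitrary: q v rule: rev_induct)
    case (snoc y p)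
    note p = snoc.prems(1) and q = snoc.prems(2)
    have q_eq: "q = butlast q @ [y]" using p q by (metis append_butlast_last_id last_snoc)
    have q': "last q = y" "hd q = r" "q \<noteq> []" using p q by auto
    show ?case
    proof (cases "p = []")
      case True
      then have "y = r" using p by simp
      have "butlast q = []"
      proof (rule ccontr)
        assume "butlast q \<noteq> []"
        then have "r \<in> set (butlast q)" using q_eq q'(2) by (metis hd_append2 hd_in_set)
        moreover have "distinct (butlast q @ [y])" using q q_eq by simp
        ultimately show False using \<open>y = r\<close> by simp
      qed
      then show ?thesis using q_eq True by simp
    next
      case False
      then have "y \<noteq> r" using p by auto
      then have ne: "butlast q \<noteq> []" using q_eq q'(2) by (metis append_Nil list.sel(1))
      have q_snoc: "hd (butlast q @ [y]) = r" "distinct (butlast q @ [y])"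
          "successively (\<lambda>x y. f y = x) (butlast q @ [y])"
        using q q_eq by simp_all
      have "p = butlast q"
        using p q_snoc False ne
        by (intro snoc.IH[of "f y"]) (auto simp: successively_append_iff)
      then show ?thesis using q_eq by simp
    qed
  qed simp
qed

lemma num_larger_ancestors_path:
  assumes "is_tree V E" "r \<in> V" "path_between E r p j"
  shows "num_larger_ancestors j (r, E) = card {i \<in> set p. i > j}"
proof -
  have "path_between E r q j \<longleftrightarrow> q = p" for q
    using tree_path_unique[OF assms(1,2) _ assms(3)] assms(3) by blast
  then have "is_ancestor (r, E) i j \<and> i > j \<longleftrightarrow> i \<in> set p \<and> i > j" for i
    by auto
  then show ?thesis by (simp add: num_larger_ancestors_def)
qed

section \<open>Trees containing a given root path\<close>

lemma successively_fun_upd_parent: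
  assumes "y \<notin> set ps"
  shows "successively (\<lambda>a b. (f(y := c)) b = a) (x # ps) \<longleftrightarrow> successively (\<lambda>a b. f b = a) (x # ps)"
  using assms by (induction ps arbitrary: x) auto

text \<open>
  Cutting the edge from \<open>y\<close> to its parent \<open>x\<close> turns \<open>y\<close> into a root. It can be restored without
  creating a cycle because \<open>x\<close> is itself a root.
\<close>
lemma bij_betw_forests_new_root:
  assumes "x \<in> R" "R \<subseteq> V" "y \<in> V - R" "y \<notin> set ps"
  shows "bij_betw (\<lambda>f. f(y := undefined))
    {f \<in> forests V R. successively (\<lambda>a b. f b = a) (x # y # ps)}
    {f \<in> forests V (insert y R). successively (\<lambda>a b. f b = a) (y # ps)}"
    (is "bij_betw _ ?A ?B")
proof (rule bij_betw_byWitness[where f' = "\<lambda>f. f(y := x)"])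
  show "\<forall>f\<in>?A. (f(y := undefined))(y := x) = f" by auto
  show "\<forall>f\<in>?B. (f(y := x))(y := undefined) = f"
    by (auto simp: forests_def PiE_def extensional_def fun_eq_iff)
  show "(\<lambda>f. f(y := undefined)) ` ?A \<subseteq> ?B"
  proof (rule image_subsetI)
    fix f assume f: "f \<in> ?A"
    then obtain d :: "'a \<Rightarrow> nat" where d: "\<forall>v\<in>V - R. d (f v) < d v" "f \<in> (V - R) \<rightarrow>\<^sub>E V"
      by (auto simp: forests_def)
    have "f(y := undefined) \<in> (V - insert y R) \<rightarrow>\<^sub>E V"
      using d(2) by (auto simp: PiE_def extensional_def)
    then have "f(y := undefined) \<in> forests V (insert y R)"
      unfolding forests_def using d(1) by (intro CollectI conjI exI[of _ d]) auto
    moreover have "successively (\<lambda>a b. (f(y := undefined)) b = a) (y # ps)"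
      using f assms(4) by (subst successively_fun_upd_parent) auto
    ultimately show "f(y := undefined) \<in> ?B" by simp
  qed
  show "(\<lambda>f. f(y := x)) ` ?B \<subseteq> ?A"
  proof (rule image_subsetI)
    fix f assume f: "f \<in> ?B"
    then obtain d :: "'a \<Rightarrow> nat"
      where d: "\<forall>v\<in>V - insert y R. d (f v) < d v" "f \<in> (V - insert y R) \<rightarrow>\<^sub>E V"
      by (auto simp: forests_def)
    have "f(y := x) \<in> (V - R) \<rightarrow>\<^sub>E V"
      using d(2) assms by (auto simp: PiE_def extensional_def)
    then have "f(y := x) \<in> forests V R"
      unfolding forests_def using d(1) assms
      by (intro CollectI conjI exI[of _ "\<lambda>v. if v \<in> R then 0 else Suc (d v)"]) auto
    moreover have "successively (\<lambda>a b. (f(y := x)) b = a) (y # ps)"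
      using f assms(4) by (subst successively_fun_upd_parent) auto
    ultimately show "f(y := x) \<in> ?A" by simp
  qed
qed

lemma card_forests_containing_path:
  assumes "x \<in> R" "R \<subseteq> V" "set ps \<subseteq> V - R" "distinct ps"
  shows "card {f \<in> forests V R. successively (\<lambda>a b. f b = a) (x # ps)} = card (forests V (R \<union> set ps))"
  using assms
proof (induction ps arbitrary: x R)
  case (Cons y ps)
  have "card {f \<in> forests V R. successively (\<lambda>a b. f b = a) (x # y # ps)}
      = card {f \<in> forests V (insert y R). successively (\<lambda>a b. f b = a) (y # ps)}"
    by (rule bij_betw_same_card, rule bij_betw_forests_new_root) (use Cons.prems in auto)
  also have "\<dots> = card (forests V (insert y R \<union> set ps))"
    by (rule Cons.IH) (use Cons.prems in auto)
  finally show ?case by simp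
qed simp

lemma card_trees_containing_path:
  assumes "finite V" "p \<noteq> []" "distinct p" "set p \<subseteq> V"
  shows "card V * card {E. is_tree V E \<and> path_between E (hd p) p (last p)}
    = length p * card V ^ (card V - length p)"
proof -
  define r where "r = hd p"
  have p: "p = r # tl p" and r: "r \<in> V" using assms by (auto simp: r_def)
  let ?F = "{f \<in> forests V {r}. successively (\<lambda>a b. f b = a) p}"
  have path: "path_between (parent_edges V r f) r p (last p) \<longleftrightarrow> successively (\<lambda>a b. f b = a) p" for f
    using assms successively_parent_edges[of p V r f] by (auto simp: path_between_def r_def)
  have "parent_edges V r ` forests V {r} = {E. is_tree V E}"
    using bij_betw_parent_edges[OF r] by (rule bij_betw_imp_surj_on)
  then have "{E. is_tree V E \<and> path_between E r p (last p)}
      = {E \<in> parent_edges V r ` forests V {r}. path_between E r p (last p)}"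
    by blast
  also have "\<dots> = parent_edges V r ` {f \<in> forests V {r}. path_between (parent_edges V r f) r p (last p)}"
    by blast
  finally have "{E. is_tree V E \<and> path_between E r p (last p)} = parent_edges V r ` ?F"
    unfolding path .
  moreover have "inj_on (parent_edges V r) ?F"
    using inj_on_parent_edges by (rule inj_on_subset) auto
  ultimately have "card {E. is_tree V E \<and> path_between E r p (last p)} = card ?F"
    by (simp add: card_image)
  also have "\<dots> = card (forests V (set p))"
  proof -
    have "distinct (r # tl p)" "set (r # tl p) \<subseteq> V" using assms p by metis+
    then have "card {f \<in> forests V {r}. successively (\<lambda>a b. f b = a) (r # tl p)}
        = card (forests V ({r} \<union> set (tl p)))"
      by (intro card_forests_containing_path) auto
    then show ?thesis using p by (metis insert_is_Un list.simps(15))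
  qed
  finally have "card V * card {E. is_tree V E \<and> path_between E r p (last p)}
      = card (set p) * card V ^ card (V - set p)"
    using card_forests[OF assms(1,4)] by simp
  then show ?thesis
    using assms by (simp add: r_def distinct_card card_Diff_subset)
qed

lemma card_rooted_labelled_trees:
  assumes "n \<ge> 1"
  shows "card (rooted_labelled_trees n) = n ^ (n - 1)"
proof -
  have "rooted_labelled_trees n = {1..n} \<times> {E. is_tree {1..n} E}"
    by (auto simp: rooted_labelled_trees_def)
  moreover have "n * card {E. is_tree {1..n} E} = n ^ (n - 1)"
    using card_trees_containing_path[of "{1..n}" "[1]"] assms by (simp add: path_between_def)
  ultimately show ?thesis by (simp only: card_cartesian_product card_atLeastAtMost diff_Suc_1)
qed

section \<open>Summation over root paths\<close>

lemma card_trees_by_root_path: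
  fixes n j k :: nat
  defines "P \<equiv> {p. p \<noteq> [] \<and> distinct p \<and> set p \<subseteq> {1..n} \<and> last p = j \<and> card {i \<in> set p. i > j} = k}"
  assumes j: "j \<in> {1..n}"
  shows "n * card {T \<in> rooted_labelled_trees n. num_larger_ancestors j T = k}
    = (\<Sum>p\<in>P. length p * n ^ (n - length p))"
proof -
  let ?V = "{1..n}"
  let ?A = "{T \<in> rooted_labelled_trees n. num_larger_ancestors j T = k}"
  let ?X = "SIGMA p:P. {E. is_tree ?V E \<and> path_between E (hd p) p j}"
  let ?h = "\<lambda>(p, E). (hd p, E)"
  have hd: "hd p \<in> ?V" if "p \<in> P" for p using that hd_in_set unfolding P_def by blast
  have "?h ` ?X = ?A"
  proof (intro equalityI subsetI)
    fix T assume "T \<in> ?h ` ?X"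
    then obtain p E where T: "T = (hd p, E)" "p \<in> P" "is_tree ?V E" "path_between E (hd p) p j"
      by auto
    then show "T \<in> ?A"
      using num_larger_ancestors_path[OF T(3) hd T(4)] hd[OF T(2)]
      by (auto simp: rooted_labelled_trees_def P_def)
  next
    fix T assume T: "T \<in> ?A"
    obtain r E where rE: "T = (r, E)" by (cases T)
    with T have r: "r \<in> ?V" and E: "is_tree ?V E" by (auto simp: rooted_labelled_trees_def)
    then obtain p where p: "path_between E r p j"
      using j unfolding is_tree_def graph_connected_def by blast
    have "set p \<subseteq> ?V" using path_between_subset[OF _ p r] E by (simp add: is_tree_def)
    then have "p \<in> P" "hd p = r"
      using p T num_larger_ancestors_path[OF E r p] rE by (auto simp: P_def path_between_def)
    then show "T \<in> ?h ` ?X" using rE E p by (force simp: image_iff)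
  qed
  moreover have "inj_on ?h ?X"
  proof (rule inj_onI)
    fix s t assume st: "s \<in> ?X" "t \<in> ?X" "?h s = ?h t"
    obtain p q E where "s = (p, E)" "t = (q, E)" "hd p = hd q"
      using st(3) by (cases s; cases t) auto
    with st tree_path_unique[of ?V E "hd p" p j q] hd[of p] show "s = t" by simp
  qed
  ultimately have "card ?A = card ?X" using card_image[of ?h ?X] by simp
  also have "\<dots> = (\<Sum>p\<in>P. card {E. is_tree ?V E \<and> path_between E (hd p) p j})"
  proof (rule card_SigmaI)
    have "P \<subseteq> {p. set p \<subseteq> ?V \<and> distinct p}" by (auto simp: P_def)
    then show "finite P" by (rule finite_subset) (rule finite_subset_distinct, simp)
    have "{E. is_tree ?V E} \<subseteq> Pow (Pow ?V)" by (auto simp: is_tree_def simple_graph_def)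
    then have "finite {E. is_tree ?V E}" by (rule finite_subset) simp
    then show "\<forall>p\<in>P. finite {E. is_tree ?V E \<and> path_between E (hd p) p j}"
      by (auto intro: finite_subset[rotated])
  qed
  finally have "n * card ?A = (\<Sum>p\<in>P. n * card {E. is_tree ?V E \<and> path_between E (hd p) p j})"
    by (simp add: sum_distrib_left)
  also have "\<dots> = (\<Sum>p\<in>P. length p * n ^ (n - length p))"
  proof (rule sum.cong[OF refl])
    fix p assume "p \<in> P"
    then show "n * card {E. is_tree ?V E \<and> path_between E (hd p) p j} = length p * n ^ (n - length p)"
      using card_trees_containing_path[of ?V p] by (auto simp: P_def)
  qed
  finally show ?thesis .
qed

text \<open>
  A path to \<open>j\<close> is an ordering of its ancestor set \<open>S\<close>, followed by \<open>j\<close>; the set \<open>S\<close> splits freely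
  into \<open>k\<close> labels above \<open>j\<close> and any set of labels below \<open>j\<close>.
\<close>
lemma sum_root_paths:
  fixes n j k :: nat and g :: "nat \<Rightarrow> nat"
  defines "P \<equiv> {p. p \<noteq> [] \<and> distinct p \<and> set p \<subseteq> {1..n} \<and> last p = j \<and> card {i \<in> set p. i > j} = k}"
  assumes j: "j \<in> {1..n}"
  shows "(\<Sum>p\<in>P. g (length p))
    = ((n - j) choose k) * (\<Sum>c\<le>j - 1. ((j - 1) choose c) * (fact (k + c) * g (Suc (k + c))))"
proof -
  define Q where "Q = {q. distinct q \<and> set q \<subseteq> {1..n} - {j} \<and> card {i \<in> set q. i > j} = k}"
  define \<S> where "\<S> = {S. S \<subseteq> {1..n} - {j} \<and> card {i \<in> S. i > j} = k}"
  let ?B = "{B. B \<subseteq> {Suc j..n} \<and> card B = k}" and ?C = "Pow {1..j - 1}"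
  have "Q \<subseteq> {q. set q \<subseteq> {1..n} \<and> distinct q}" by (auto simp: Q_def)
  then have finQ: "finite Q" by (rule finite_subset) (rule finite_subset_distinct, simp)
  have finS: "finite \<S>" unfolding \<S>_def by (rule finite_subset[of _ "Pow {1..n}"]) auto
  have snoc: "{i \<in> insert j S. i > j} = {i \<in> S. i > j}" for S by auto
  have "(\<Sum>p\<in>P. g (length p)) = (\<Sum>q\<in>Q. g (Suc (length q)))"
  proof (rule sum.reindex_bij_witness[where i = "\<lambda>q. q @ [j]" and j = butlast])
    fix p assume "p \<in> P"
    then have p: "p = butlast p @ [j]" "distinct p" "set p \<subseteq> {1..n}" "card {i \<in> set p. i > j} = k"
      unfolding P_def by (auto intro: append_butlast_last_id[symmetric])
    show "butlast p @ [j] = p" using p(1) by simp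
    have "distinct (butlast p @ [j])" "set (butlast p @ [j]) \<subseteq> {1..n}"
      using p by metis+
    moreover have "set p = insert j (set (butlast p))"
      by (subst p(1)) simp
    then have "card {i \<in> set (butlast p). i > j} = k" using p(4) snoc by simp
    ultimately show "butlast p \<in> Q" by (auto simp: Q_def)
    show "g (Suc (length (butlast p))) = g (length p)" using p(1) by (metis length_append_singleton)
  next
    fix q assume "q \<in> Q"
    then have q: "distinct q" "set q \<subseteq> {1..n} - {j}" "card {i \<in> set q. i > j} = k"
      by (auto simp: Q_def)
    have "card {i \<in> set (q @ [j]). i > j} = k" using q(3) snoc[of "set q"] by simp
    then show "q @ [j] \<in> P" using j q(1,2) unfolding P_def by auto
  qed simp
  also have "\<dots> = (\<Sum>S\<in>\<S>. \<Sum>q\<in>{q \<in> Q. set q = S}. g (Suc (length q)))"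
    by (rule sum.group[symmetric, OF finQ finS]) (auto simp: Q_def \<S>_def)
  also have "\<dots> = (\<Sum>S\<in>\<S>. fact (card S) * g (Suc (card S)))"
  proof (rule sum.cong[OF refl])
    fix S assume S: "S \<in> \<S>"
    then have "finite S" by (auto simp: \<S>_def intro: finite_subset)
    moreover have "{q \<in> Q. set q = S} = permutations_of_set S"
      using S by (auto simp: Q_def \<S>_def permutations_of_set_def)
    ultimately show "(\<Sum>q\<in>{q \<in> Q. set q = S}. g (Suc (length q))) = fact (card S) * g (Suc (card S))"
      by (simp add: length_finite_permutations_of_set)
  qed
  also have "\<dots> = (\<Sum>(B, C)\<in>?B \<times> ?C. fact (k + card C) * g (Suc (k + card C)))"
  proof (rule sum.reindex_bij_witness[where i = "\<lambda>(B, C). B \<union> C"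
        and j = "\<lambda>S. ({i \<in> S. i > j}, {i \<in> S. i < j})"])
    fix S assume S: "S \<in> \<S>"
    then have split: "S = {i \<in> S. i > j} \<union> {i \<in> S. i < j}" by (auto simp: \<S>_def)
    then show "(case ({i \<in> S. i > j}, {i \<in> S. i < j}) of (B, C) \<Rightarrow> B \<union> C) = S" by simp
    show "({i \<in> S. i > j}, {i \<in> S. i < j}) \<in> ?B \<times> ?C" using S by (auto simp: \<S>_def)
    have "finite S" using S by (auto simp: \<S>_def intro: finite_subset)
    then have "card ({i \<in> S. i > j} \<union> {i \<in> S. i < j}) = card {i \<in> S. i > j} + card {i \<in> S. i < j}"
      by (intro card_Un_disjoint) auto
    then have "card S = k + card {i \<in> S. i < j}" using S split by (simp add: \<S>_def)
    then show "(case ({i \<in> S. i > j}, {i \<in> S. i < j}) of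
        (B, C) \<Rightarrow> fact (k + card C) * g (Suc (k + card C))) = fact (card S) * g (Suc (card S))"
      by simp
  next
    fix t assume "t \<in> ?B \<times> ?C"
    then obtain B C where t: "t = (B, C)" "B \<subseteq> {Suc j..n}" "card B = k" "C \<subseteq> {1..j - 1}" by auto
    have *: "{i \<in> B \<union> C. i > j} = B" "{i \<in> B \<union> C. i < j} = C"
      using t(2,4) by force+
    then show "({i \<in> (case t of (B, C) \<Rightarrow> B \<union> C). i > j}, {i \<in> (case t of (B, C) \<Rightarrow> B \<union> C). i < j}) = t"
      by (simp add: t)
    have "B \<union> C \<subseteq> {1..n} - {j}" using t(2,4) j by force
    then show "(case t of (B, C) \<Rightarrow> B \<union> C) \<in> \<S>" using * t by (simp add: \<S>_def)
  qed
  also have "\<dots> = card ?B * (\<Sum>C\<in>?C. fact (k + card C) * g (Suc (k + card C)))"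
    by (simp add: sum.cartesian_product[symmetric])
  also have "card ?B = (n - j) choose k"
    using n_subsets[of "{Suc j..n}" k] by simp
  also have "(\<Sum>C\<in>?C. fact (k + card C) * g (Suc (k + card C)))
      = (\<Sum>c\<le>j - 1. ((j - 1) choose c) * (fact (k + c) * g (Suc (k + c))))"
    using sum_Pow_card[of "{1..j - 1}" "\<lambda>c. fact (k + c) * g (Suc (k + c))"] by simp
  finally show ?thesis .
qed

lemma path_weight_binomials:
  assumes "j + k \<le> n" "c < j"
  defines "l \<equiv> n - Suc (k + c)"
  shows "real ((n - j) choose k) * (real ((j - 1) choose c) * fact (k + c))
    = fact (j - 1) * fact (n - j) *
      (real (l choose (n - j - k)) * real ((n - l - 1) choose k)) / fact l"
proof -
  have l: "n - l - 1 = k + c" "l - (n - j - k) = j - 1 - c" "n - j - k \<le> l"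
    using assms by auto
  have "real ((n - j) choose k) = fact (n - j) / (fact k * fact (n - j - k))"
    using assms(1) by (intro binomial_fact) simp
  moreover have "real ((j - 1) choose c) = fact (j - 1) / (fact c * fact (j - 1 - c))"
    using assms(2) by (intro binomial_fact) simp
  moreover have "real ((k + c) choose k) = fact (k + c) / (fact k * fact c)"
    using binomial_fact[of k "k + c", where 'a = real] by simp
  moreover have "real (l choose (n - j - k)) = fact l / (fact (n - j - k) * fact (j - 1 - c))"
    using binomial_fact[OF l(3), where 'a = real] unfolding l(2) .
  ultimately show ?thesis unfolding l(1) by (simp add: mult_ac)
qed

theorem mainTheorem4:
  fixes n j k :: nat
  assumes "1 \<le> j" and "j \<le> n" and "k \<le> n - j"
  shows "measure_pmf.prob (pmf_of_set (rooted_labelled_trees n)) {T. num_larger_ancestors j T = k} =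
    fact (j - 1) * fact (n - j) / real n ^ (n - 1) *
    (\<Sum>l = n - j - k..n - k - 1.
       real (l choose (n - j - k)) * real ((n - l - 1) choose k) *
       (real (n - l) * real n powi (int l - 1) / fact l))"
proof -
  let ?A = "{T \<in> rooted_labelled_trees n. num_larger_ancestors j T = k}"
  let ?term = "\<lambda>l. real (l choose (n - j - k)) * real ((n - l - 1) choose k) *
       (real (n - l) * real n powi (int l - 1) / fact l)"
  have n: "n \<ge> 1" and j: "j \<in> {1..n}" using assms by auto
  have "n * card ?A = ((n - j) choose k) * (\<Sum>c\<le>j - 1. ((j - 1) choose c) *
      (fact (k + c) * (Suc (k + c) * n ^ (n - Suc (k + c)))))"
    unfolding card_trees_by_root_path[OF j] by (rule sum_root_paths[OF j])
  from arg_cong[OF this, of real]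
  have "real n * real (card ?A) = (\<Sum>c\<le>j - 1. real ((n - j) choose k) *
      (real ((j - 1) choose c) * fact (k + c)) * (real (Suc (k + c)) * real n ^ (n - Suc (k + c))))"
    by (simp add: sum_distrib_left mult.assoc del: of_nat_Suc mult_Suc mult_Suc_right)
  also have "\<dots> = (\<Sum>c\<le>j - 1. real n * (fact (j - 1) * fact (n - j) * ?term (n - Suc (k + c))))"
  proof (rule sum.cong[OF refl])
    fix c assume "c \<in> {..j - 1}"
    then have c: "c < j" "j + k \<le> n" using assms by auto
    define l where "l = n - Suc (k + c)"
    have *: "Suc (k + c) = n - l" using c by (simp add: l_def)
    have powi: "real n ^ l = real n * real n powi (int l - 1)"
      using n by (simp add: power_int_diff)
    show "real ((n - j) choose k) * (real ((j - 1) choose c) * fact (k + c)) *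
        (real (Suc (k + c)) * real n ^ (n - Suc (k + c)))
      = real n * (fact (j - 1) * fact (n - j) * ?term (n - Suc (k + c)))"
      unfolding path_weight_binomials[OF c(2,1)] l_def[symmetric] unfolding * powi by simp
  qed
  also have "\<dots> = real n * (fact (j - 1) * fact (n - j) * (\<Sum>c\<le>j - 1. ?term (n - Suc (k + c))))"
    by (simp add: sum_distrib_left)
  also have "(\<Sum>c\<le>j - 1. ?term (n - Suc (k + c))) = (\<Sum>l = n - j - k..n - k - 1. ?term l)"
    by (rule sum.reindex_bij_witness[where i = "\<lambda>l. n - Suc (k + l)" and j = "\<lambda>c. n - Suc (k + c)"])
      (use assms in auto)
  finally have card_A: "real (card ?A) = fact (j - 1) * fact (n - j) * (\<Sum>l = n - j - k..n - k - 1. ?term l)"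
    using n by simp
  have "measure_pmf.prob (pmf_of_set (rooted_labelled_trees n)) {T. num_larger_ancestors j T = k}
      = real (card ?A) / real (card (rooted_labelled_trees n))"
    using measure_pmf_of_set[OF rooted_labelled_trees_nonempty[OF n] finite_rooted_labelled_trees]
    by (simp add: Int_def)
  then show ?thesis unfolding card_A card_rooted_labelled_trees[OF n] by simp
qed

end
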